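(* Let $R$ be a 2-fir and let $\Delta$ be an $F$-algebraic set of atoms of $R$ of finite rank $r=rk(\Delta)$. Then $\Delta$ intersects only finitely many similarity classes. More precisely, there exist $n\le r$ pairwise non-similar atoms $p_1,\dots,p_n$ of $R$ such that $\Delta=\bigcup_{i=1}^n\Delta_i$, where $\Delta_i=\Delta\cap\Delta(p_i)$ for $i\in\{1,\dots,n\}$. Moreover, if $B_i$ is an $F$-basis for $\Delta_i$ ($1\le i\le n$), then $B:=\bigcup_{i=1}^n B_i$ is an $F$-basis for $\Delta$, and $$rk(\Delta)=\sum_{i=1}^n rk(\Delta_i),\qquad \overline{\Delta}=\bigcup_{i=1}^n\overline{\Delta_i}.$$ In particular, if $f\in\mathcal F$, then $V(f)$ intersects at most $\ell(f)$ similarity classes.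
   Context: Rings are associative with $1$, not necessarily commutative. A 2-fir is a domain $R$ such that for all $a,b\in R$ with $aR\cap bR\neq 0$ there are $c,d\in R$ with $aR\cap bR=cR$ and $aR+bR=dR$ (this condition is left-right symmetric). $U(R)$ is the group of units. An atom is a nonzero non-unit that is not a product of two non-units; $\mathcal A$ is the set of atoms. The length $\ell(a)$ of $a$ is the least $n$ such that $a$ is a product of $n$ atoms, $0$ if $a$ is a unit, and $\infty$ if $a$ is neither a unit nor a finite product of atoms; $\mathcal F=\{x\in R: \ell(x)<\infty\}$ (so $0\notin\mathcal F$, $U(R)\subseteq\mathcal F$). Nonzero elements $a,a'$ are similar if $R/Ra\cong R/Ra'$ as left $R$-modules; $\Delta(a)$ denotes the similarity class of $a$. The intersection of an empty family of left ideals is $R$. A subset $\Delta\subseteq\mathcal F\setminus U(R)$ is $F$-algebraic if $\bigcap_{\delta\in\Delta}R\delta\neq0$. For $\Delta$ $F$-algebraic, $d\in\mathcal F$ is $F$-dependent on $\Delta$ if $\Delta\cup\{d\}$ is $F$-algebraic and there is a finite subset $\Gamma\subseteq\Delta$ with $Rd+\bigcap_{\gamma\in\Gamma}R\gamma\neq R$. $\Delta$ is $F$-independent if no $\delta\in\Delta$ is $F$-dependent on $\Delta\setminus\{\delta\}$. An $F$-basis of $\Delta$ is an $F$-independent subset $B\subseteq\Delta$ such that every element of $\Delta$ is $F$-dependent on $B$. For an $F$-algebraic set $\Delta$ of atoms, $rk(\Delta)=|B|$ for any $F$-basis $B$ of $\Delta$ (every such $\Delta$ has an $F$-basis, and all $F$-bases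 have the same cardinality). The closure $\overline{\Delta}$ is the set of atoms that are $F$-dependent on $\Delta$. For $a\in R\setminus\{0\}$, $V(a)=\{p\in\mathcal A: a\in Rp\}$, an $F$-algebraic set. *)

theory Defs
  imports "HOL-Library.Set_Algebras" "HOL-Library.Extended_Nat"
begin

definition left_ideal :: "'a::ring_1 \<Rightarrow> 'a set" where
  "left_ideal a = range (\<lambda>r. r * a)"

text \<open>The class axiom has to be stated without auxiliary constants of sort \<open>ring_1\<close>; here
  \<open>range ((*) a)\<close> is the right ideal \<open>aR\<close>.\<close>

class two_fir = ring_1_no_zero_divisors +
  assumes two_fir:
    "range ((*) a) \<inter> range ((*) b) \<noteq> {0} \<Longrightarrow>
      \<exists>c d. range ((*) a) \<inter> range ((*) b) = range ((*) c) \<and>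
            {a * r + b * s | r s. True} = range ((*) d)"


subsection \<open>Units, atoms and length\<close>

definition ring_units :: "'a::ring_1 set" where
  "ring_units = {u. \<exists>v. u * v = 1 \<and> v * u = 1}"

definition atoms :: "'a::ring_1 set" where
  "atoms = {a. a \<noteq> 0 \<and> a \<notin> ring_units \<and>
               \<not> (\<exists>b c. b \<notin> ring_units \<and> c \<notin> ring_units \<and> a = b * c)}"

definition atom_product :: "nat \<Rightarrow> 'a::ring_1 \<Rightarrow> bool" where
  "atom_product n a \<longleftrightarrow> (\<exists>ps. length ps = n \<and> set ps \<subseteq> atoms \<and> prod_list ps = a)"

definition ell :: "'a::ring_1 \<Rightarrow> enat" where
  "ell a = (if a \<in> ring_units then 0
            else if \<exists>n. atom_product n a then enat (LEAST n. atom_product n a)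
            else \<infinity>)"

definition fin_length :: "'a::ring_1 set" where
  "fin_length = {x. ell x < \<infinity>}"


subsection \<open>Similarity\<close>

text \<open>For a left ideal \<open>I\<close>, the elements of \<open>R/I\<close> are the cosets \<open>x +o I\<close>.  Cosets are added
  elementwise, and \<open>r\<close> maps \<open>x +o I\<close> to \<open>(r *o (x +o I)) + I\<close>; the summand \<open>I\<close> is
  needed since \<open>r *o (x +o I)\<close> may be a proper subset of a coset.  The two lemmas below confirm
  that these are the usual operations.\<close>

definition quot :: "'a::ring_1 set \<Rightarrow> 'a set set" where
  "quot I = range (\<lambda>x. x +o I)"

definition quot_smult :: "'a::ring_1 set \<Rightarrow> 'a \<Rightarrow> 'a set \<Rightarrow> 'a set" where
  "quot_smult I r X = (r *o X) + I"

lemma quot_add_left_ideal: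
  "(x +o left_ideal a) + (y +o left_ideal a) = (x + y) +o left_ideal a"
proof -
  have "left_ideal a + left_ideal a = left_ideal a"
  proof
    show "left_ideal a + left_ideal a \<subseteq> left_ideal a"
      by (auto simp: left_ideal_def set_plus_def simp flip: distrib_right)
    show "left_ideal a \<subseteq> left_ideal a + left_ideal a"
    proof
      fix z assume "z \<in> left_ideal a"
      moreover have "0 \<in> left_ideal a"
        unfolding left_ideal_def by (rule range_eqI[of _ _ 0]) simp
      ultimately have "0 + z \<in> left_ideal a + left_ideal a" by (intro set_plus_intro)
      then show "z \<in> left_ideal a + left_ideal a" by simp
    qed
  qed
  then show ?thesis by (simp add: set_plus_rearrange)
qed

lemma quot_smult_left_ideal:
  "quot_smult (left_ideal a) r (x +o left_ideal a) = (r * x) +o left_ideal a"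
proof
  show "quot_smult (left_ideal a) r (x +o left_ideal a) \<subseteq> (r * x) +o left_ideal a"
  proof
    fix z assume "z \<in> quot_smult (left_ideal a) r (x +o left_ideal a)"
    then obtain s t where "z = r * (x + s * a) + t * a"
      by (auto simp: quot_smult_def left_ideal_def set_plus_def elt_set_plus_def elt_set_times_def)
    then have "z = r * x + (r * s + t) * a" by (simp add: algebra_simps)
    then show "z \<in> (r * x) +o left_ideal a"
      by (auto simp: left_ideal_def elt_set_plus_def)
  qed
  show "(r * x) +o left_ideal a \<subseteq> quot_smult (left_ideal a) r (x +o left_ideal a)"
  proof
    fix z assume "z \<in> (r * x) +o left_ideal a"
    then obtain t where "z = r * (x + 0 * a) + t * a"
      by (auto simp: left_ideal_def elt_set_plus_def)
    then show "z \<in> quot_smult (left_ideal a) r (x +o left_ideal a)"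
      unfolding quot_smult_def left_ideal_def set_plus_def elt_set_plus_def elt_set_times_def
      by blast
  qed
qed

definition quot_iso :: "'a::ring_1 set \<Rightarrow> 'a set \<Rightarrow> bool" where
  "quot_iso I J \<longleftrightarrow>
    (\<exists>\<phi>. bij_betw \<phi> (quot I) (quot J) \<and>
         (\<forall>X\<in>quot I. \<forall>Y\<in>quot I. \<phi> (X + Y) = \<phi> X + \<phi> Y) \<and>
         (\<forall>r. \<forall>X\<in>quot I. \<phi> (quot_smult I r X) = quot_smult J r (\<phi> X)))"

definition similar :: "'a::ring_1 \<Rightarrow> 'a \<Rightarrow> bool" where
  "similar a b \<longleftrightarrow> a \<noteq> 0 \<and> b \<noteq> 0 \<and> quot_iso (left_ideal a) (left_ideal b)"

definition sim_class :: "'a::ring_1 \<Rightarrow> 'a set" where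
  "sim_class a = {b. similar a b}"

definition sim_classes_meeting :: "'a::ring_1 set \<Rightarrow> 'a set set" where
  "sim_classes_meeting \<Delta> = {C. \<exists>a. a \<noteq> 0 \<and> C = sim_class a \<and> C \<inter> \<Delta> \<noteq> {}}"


subsection \<open>F-dependence\<close>

definition F_algebraic :: "'a::ring_1 set \<Rightarrow> bool" where
  "F_algebraic \<Delta> \<longleftrightarrow> \<Delta> \<subseteq> fin_length - ring_units \<and> (\<Inter>\<delta>\<in>\<Delta>. left_ideal \<delta>) \<noteq> {0}"

definition F_dependent :: "'a::ring_1 \<Rightarrow> 'a set \<Rightarrow> bool" where
  "F_dependent d \<Delta> \<longleftrightarrow>
    F_algebraic \<Delta> \<and> d \<in> fin_length \<and> F_algebraic (\<Delta> \<union> {d}) \<and>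
    (\<exists>\<Gamma>. finite \<Gamma> \<and> \<Gamma> \<subseteq> \<Delta> \<and> left_ideal d + (\<Inter>\<gamma>\<in>\<Gamma>. left_ideal \<gamma>) \<noteq> UNIV)"

definition F_independent :: "'a::ring_1 set \<Rightarrow> bool" where
  "F_independent \<Delta> \<longleftrightarrow> F_algebraic \<Delta> \<and> (\<forall>\<delta>\<in>\<Delta>. \<not> F_dependent \<delta> (\<Delta> - {\<delta>}))"

definition F_basis :: "'a::ring_1 set \<Rightarrow> 'a set \<Rightarrow> bool" where
  "F_basis B \<Delta> \<longleftrightarrow>
    F_algebraic \<Delta> \<and> B \<subseteq> \<Delta> \<and> F_independent B \<and> (\<forall>\<delta>\<in>\<Delta>. F_dependent \<delta> B)"

definition ecard :: "'b set \<Rightarrow> enat" where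
  "ecard A = (if finite A then enat (card A) else \<infinity>)"

text \<open>Meaningful for F-algebraic sets of atoms of a 2-fir: these have an F-basis, and all F-bases
  have the same cardinality.  Infinite cardinalities are not distinguished.\<close>

definition rk :: "'a::ring_1 set \<Rightarrow> enat" where
  "rk \<Delta> = ecard (SOME B. F_basis B \<Delta>)"

definition F_closure :: "'a::ring_1 set \<Rightarrow> 'a set" where
  "F_closure \<Delta> = {p \<in> atoms. F_dependent p \<Delta>}"

definition V :: "'a::ring_1 \<Rightarrow> 'a set" where
  "V a = {p \<in> atoms. a \<in> left_ideal p}"

end

theory Submission
  imports Defs
begin

text \<open>For an atom \<open>p\<close> every principal left ideal containing \<open>Rp\<close> is \<open>Rp\<close> or \<open>R\<close>.  Over a 2-fir this
  turns dependence of \<open>p\<close> on \<open>\<Delta>\<close> into the inclusion \<open>(\<Inter>\<gamma>\<in>\<Gamma>. R\<gamma>) \<subseteq> Rp\<close> for some finite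
  \<open>\<Gamma> \<subseteq> \<Delta>\<close>.  By modularity, if \<open>Rm \<inter> Rq \<subseteq> Rp\<close> but not \<open>Rm \<subseteq> Rp\<close>, then \<open>Rm \<inter> Rq = Rm \<inter> Rp\<close>
  and \<open>R/Rq \<cong> Rm/(Rm \<inter> Rq) = Rm/(Rm \<inter> Rp) \<cong> R/Rp\<close>.  The equality is the exchange property, and
  the isomorphism shows that the \<open>\<gamma> \<in> \<Gamma>\<close> that are not similar to \<open>p\<close> can be dropped from \<open>\<Gamma>\<close>,
  so that dependence splits along similarity classes.  The same transposition of factors shows that an
  atomic right factor of a product of atoms is similar to one of them, which bounds the classes
  meeting \<open>V(f)\<close>.\<close>

section \<open>Principal left ideals of a 2-fir\<close>

lemma mem_left_ideal: "x \<in> left_ideal a \<longleftrightarrow> (\<exists>r. x = r * a)"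
  by (auto simp: left_ideal_def)

lemma left_ideal_self [simp]: "a \<in> left_ideal a"
  unfolding mem_left_ideal by (rule exI[of _ 1]) simp

lemma left_ideal_zero [simp]: "0 \<in> left_ideal a"
  unfolding mem_left_ideal by (rule exI[of _ 0]) simp

lemma left_ideal_mult: "x \<in> left_ideal a \<Longrightarrow> r * x \<in> left_ideal a"
  unfolding mem_left_ideal by (metis mult.assoc)

lemma left_ideal_add: "x \<in> left_ideal a \<Longrightarrow> y \<in> left_ideal a \<Longrightarrow> x + y \<in> left_ideal a"
  unfolding mem_left_ideal by (metis distrib_right)

lemma left_ideal_diff: "x \<in> left_ideal a \<Longrightarrow> y \<in> left_ideal a \<Longrightarrow> x - y \<in> left_ideal a"
  unfolding mem_left_ideal by (metis left_diff_distrib)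

lemma left_ideal_subset_iff: "left_ideal a \<subseteq> left_ideal b \<longleftrightarrow> a \<in> left_ideal b"
  using left_ideal_self left_ideal_mult by (metis mem_left_ideal subset_iff)

lemma mem_sum_left_ideals:
  "x \<in> left_ideal a + left_ideal b \<longleftrightarrow> (\<exists>r s. x = r * a + s * b)"
  by (simp add: set_plus_def left_ideal_def)

text \<open>The pair \<open>(x0, y0)\<close> generates all solutions of \<open>a * x = b * y\<close>; it is a column of an
  invertible \<open>2 \<times> 2\<close> matrix, and the inverse matrix gives the left-hand version of the axiom.\<close>

lemma two_fir_left:
  fixes s t z :: "'a::two_fir"
  assumes "z \<in> left_ideal s" "z \<in> left_ideal t" "z \<noteq> 0"
  obtains c d where "left_ideal s \<inter> left_ideal t = left_ideal c"
    and "left_ideal s + left_ideal t = left_ideal d"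
proof -
  obtain a b where z: "z = a * s" "z = b * t" using assms(1,2) unfolding mem_left_ideal by blast
  have ab: "a \<noteq> 0" "b \<noteq> 0" using z assms(3) by auto
  have zin: "z \<in> range ((*) a) \<inter> range ((*) b)"
    using z by (metis IntI rangeI)
  with assms(3) have "range ((*) a) \<inter> range ((*) b) \<noteq> {0}" by blast
  from two_fir[OF this] obtain c d where c: "range ((*) a) \<inter> range ((*) b) = range ((*) c)"
    and d: "{a * r + b * s | r s. True} = range ((*) d)" by blast
  have "c * 1 \<in> range ((*) c)" by blast
  then have "c \<in> range ((*) a) \<inter> range ((*) b)" unfolding c by simp
  then obtain x0 y0 where c0: "c = a * x0" "c = b * y0" by blast
  have sol: "\<exists>w. x = x0 * w \<and> y = y0 * w" if "a * x = b * y" for x y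
  proof -
    have "a * x \<in> range ((*) a) \<inter> range ((*) b)" using that by (metis IntI rangeI)
    then obtain w where "a * x = c * w" unfolding c by blast
    then have "a * x = a * (x0 * w)" "b * y = b * (y0 * w)" using c0 that by (metis mult.assoc)+
    then show ?thesis using ab by auto
  qed
  have "c \<noteq> 0" using zin assms(3) unfolding c by auto
  then have x0: "x0 \<noteq> 0" using c0 by auto
  have "d * 1 \<in> range ((*) d)" by blast
  then have "d \<in> {a * r + b * s | r s. True}" unfolding d by simp
  then obtain u v where uv: "d = a * u + b * v" by blast
  have "a * 1 + b * 0 \<in> {a * r + b * s | r s. True}" by blast
  then obtain a' where a': "a = d * a'" unfolding d by auto
  have "a * 0 + b * 1 \<in> {a * r + b * s | r s. True}" by blast
  then obtain b' where b': "b = d * b'" unfolding d by auto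
  have d0: "d \<noteq> 0" using a' ab by auto
  have "d * (a' * x0) = d * (b' * y0)" using c0 a' b' by (metis mult.assoc)
  then have ab0: "a' * x0 = b' * y0" using d0 by simp
  \<comment> \<open>The equations for \<open>c'\<close> and \<open>d'\<close> say that the matrix
    with rows \<open>u, x0\<close> and \<open>-v, y0\<close> times the matrix with rows
    \<open>a', -b'\<close> and \<open>c', d'\<close> is the identity. Both come from solutions of
    \<open>a * x = b * y\<close> that \<open>d = a * u + b * v\<close> supplies.\<close>
  have "a * (u * a') + b * (v * a') = (a * u + b * v) * a'" by (simp add: distrib_right mult.assoc)
  also have "\<dots> = a" unfolding uv[symmetric] a'[symmetric] ..
  finally have "a * (1 - u * a') = b * (v * a')"
    by (metis add_diff_cancel_left' mult.right_neutral right_diff_distrib)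
  then obtain c' where c': "1 - u * a' = x0 * c'" "v * a' = y0 * c'" using sol by blast
  have "a * (u * b') + b * (v * b') = (a * u + b * v) * b'" by (simp add: distrib_right mult.assoc)
  also have "\<dots> = b" unfolding uv[symmetric] b'[symmetric] ..
  finally have "a * (u * b') = b * (1 - v * b')"
    by (metis add_diff_cancel_right' mult.right_neutral right_diff_distrib)
  then obtain d' where d': "u * b' = x0 * d'" "1 - v * b' = y0 * d'" using sol by blast
  \<comment> \<open>An entry of the matrix product in the other order: it holds after multiplication
    by \<open>x0\<close> on the left, which cancels.\<close>
  have "x0 * (c' * x0 + d' * y0) = (x0 * c') * x0 + (x0 * d') * y0"
    by (simp add: distrib_left mult.assoc)
  also have "\<dots> = x0" unfolding c'(1)[symmetric] d'(1)[symmetric]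
    by (simp add: left_diff_distrib mult.assoc ab0)
  finally have one: "c' * x0 + d' * y0 = 1" using x0 by simp
  \<comment> \<open>\<open>s\<close> and \<open>t\<close> themselves solve
    \<open>a * x = b * y\<close>, which yields the common right factor \<open>e\<close>; by
    \<open>one\<close>, \<open>e = c' * s + d' * t\<close>.\<close>
  obtain e where e: "s = x0 * e" "t = y0 * e" using sol z by metis
  have e0: "e \<noteq> 0" using e z assms(3) by auto
  have "d * (a' * s) = d * (b' * t)" using z a' b' by (metis mult.assoc)
  then have abst: "a' * s = b' * t" using d0 by simp
  have "left_ideal s + left_ideal t = left_ideal e"
  proof (intro equalityI subsetI)
    fix x assume "x \<in> left_ideal s + left_ideal t"
    then show "x \<in> left_ideal e" unfolding mem_sum_left_ideals mem_left_ideal e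
      by (metis distrib_right mult.assoc)
  next
    fix x assume "x \<in> left_ideal e"
    then obtain r where "x = r * ((c' * x0 + d' * y0) * e)" unfolding mem_left_ideal one by auto
    then have "x = (r * c') * s + (r * d') * t" by (simp add: e algebra_simps)
    then show "x \<in> left_ideal s + left_ideal t" unfolding mem_sum_left_ideals by blast
  qed
  moreover have "left_ideal s \<inter> left_ideal t = left_ideal (a' * s)"
  proof (intro equalityI subsetI)
    fix x assume "x \<in> left_ideal s \<inter> left_ideal t"
    then obtain \<alpha> \<beta> where ab': "x = \<alpha> * s" "x = \<beta> * t"
      by (metis IntE mem_left_ideal)
    then have eq: "\<alpha> * x0 = \<beta> * y0" using e e0 by (metis mult.assoc mult_right_cancel)
    \<comment> \<open>Passing from \<open>x0\<close> to \<open>y0\<close> by \<open>eq\<close> and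
      from \<open>y0 * c'\<close> to \<open>v * a'\<close> makes \<open>a'\<close> a right factor of
      \<open>\<alpha>\<close>.\<close>
    have "\<alpha> = \<alpha> * (u * a' + x0 * c')" using c'(1) by (metis diff_add_cancel add.commute mult.right_neutral)
    also have "\<dots> = \<alpha> * u * a' + \<beta> * (y0 * c')" by (simp add: distrib_left eq flip: mult.assoc)
    also have "\<dots> = (\<alpha> * u + \<beta> * v) * a'" by (simp add: distrib_right mult.assoc flip: c'(2))
    finally show "x \<in> left_ideal (a' * s)" using ab'(1) unfolding mem_left_ideal by (metis mult.assoc)
  next
    fix x assume "x \<in> left_ideal (a' * s)"
    then obtain r where "x = r * (a' * s)" unfolding mem_left_ideal by blast
    moreover from this have "x = r * (b' * t)" unfolding abst .
    ultimately show "x \<in> left_ideal s \<inter> left_ideal t"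
      by (metis IntI left_ideal_mult left_ideal_self)
  qed
  ultimately show ?thesis using that by blast
qed

section \<open>Atoms\<close>

lemma one_sided_unit:
  fixes x y :: "'a::ring_1_no_zero_divisors"
  assumes "x * y = 1" shows "x \<in> ring_units" "y \<in> ring_units"
proof -
  have "(y * x - 1) * y = 0" using assms by (simp add: left_diff_distrib mult.assoc)
  moreover have "y \<noteq> 0" using assms by auto
  ultimately have "y * x = 1" by simp
  with assms show "x \<in> ring_units" "y \<in> ring_units" by (auto simp: ring_units_def)
qed

lemma one_mem_left_ideal_iff:
  fixes a :: "'a::ring_1_no_zero_divisors"
  shows "1 \<in> left_ideal a \<longleftrightarrow> a \<in> ring_units"
proof
  assume "1 \<in> left_ideal a"
  then show "a \<in> ring_units" unfolding mem_left_ideal using one_sided_unit(2) by metis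
qed (auto simp: ring_units_def mem_left_ideal)

lemma atom_nonzero: "p \<in> atoms \<Longrightarrow> p \<noteq> 0"
  and atom_not_unit: "p \<in> atoms \<Longrightarrow> p \<notin> ring_units"
  by (auto simp: atoms_def)

lemma one_notin_left_ideal_atom:
  fixes p :: "'a::ring_1_no_zero_divisors"
  shows "p \<in> atoms \<Longrightarrow> 1 \<notin> left_ideal p"
  by (simp add: one_mem_left_ideal_iff atom_not_unit)

lemma atom_in_fin_length: "p \<in> atoms \<Longrightarrow> p \<in> fin_length"
proof -
  assume p: "p \<in> atoms"
  then have "atom_product 1 p" unfolding atom_product_def by (intro exI[of _ "[p]"]) auto
  then have "\<exists>n. atom_product n p" by blast
  then show ?thesis using atom_not_unit[OF p] by (simp add: fin_length_def ell_def)
qed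

text \<open>In \<open>p = x * y\<close> one factor is a unit. The maximality is among principal left
  ideals only, so a sum \<open>Rx + Rp\<close> has to be known to be principal before this applies
  to it.\<close>

lemma atom_left_ideal_maximal:
  fixes p y :: "'a::ring_1_no_zero_divisors"
  assumes "p \<in> atoms" "p \<in> left_ideal y"
  shows "1 \<in> left_ideal y \<or> y \<in> left_ideal p"
proof -
  obtain x where x: "p = x * y" using assms by (auto simp: mem_left_ideal)
  with assms(1) consider "x \<in> ring_units" | "y \<in> ring_units" unfolding atoms_def by blast
  then show ?thesis
  proof cases
    case 1
    then obtain x' where "x' * x = 1" by (auto simp: ring_units_def)
    then have "y = x' * p" using x by (simp flip: mult.assoc)
    then show ?thesis by (auto simp: mem_left_ideal)
  qed (simp add: one_mem_left_ideal_iff)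
qed

text \<open>The common multiple \<open>z\<close> makes \<open>Rx + Rp\<close> principal. As
  \<open>x\<close> lies outside \<open>Rp\<close>, this ideal is larger than \<open>Rp\<close>,
  hence equal to \<open>R\<close>.\<close>

lemma atom_comaximal:
  fixes p x z :: "'a::two_fir"
  assumes p: "p \<in> atoms" and z: "z \<in> left_ideal p" "z \<in> left_ideal x" "z \<noteq> 0"
    and x: "x \<notin> left_ideal p"
  obtains \<alpha> \<beta> where "\<alpha> * x + \<beta> * p = 1"
proof -
  obtain d where d: "left_ideal x + left_ideal p = left_ideal d"
    using two_fir_left[OF z(2,1,3)] by metis
  have "p = 0 * x + 1 * p" by simp
  then have "p \<in> left_ideal d" unfolding d[symmetric] mem_sum_left_ideals by blast
  moreover have "x = 1 * x + 0 * p" by simp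
  then have "x \<in> left_ideal d" unfolding d[symmetric] mem_sum_left_ideals by blast
  ultimately have "1 \<in> left_ideal d"
    using atom_left_ideal_maximal[OF p] x left_ideal_subset_iff by blast
  then show ?thesis unfolding d[symmetric] mem_sum_left_ideals using that by metis
qed

text \<open>No principal left ideal lies strictly between \<open>Rm \<inter> Rq\<close> and
  \<open>Rm\<close>. This is the modular law: if \<open>x\<close> is not in \<open>Rq\<close>, then
  \<open>Rx + Rq = R\<close>, so \<open>Rm = Rx + (Rm \<inter> Rq) = Rx\<close>.\<close>

lemma Int_atom_covered:
  fixes m q x z :: "'a::two_fir"
  assumes q: "q \<in> atoms" and z: "z \<in> left_ideal m" "z \<in> left_ideal q" "z \<noteq> 0"
    and sub: "left_ideal m \<inter> left_ideal q \<subseteq> left_ideal x" and x: "x \<in> left_ideal m"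
  shows "x \<in> left_ideal q \<or> m \<in> left_ideal x"
proof (cases "x \<in> left_ideal q")
  case False
  moreover have "z \<in> left_ideal x" using z sub by blast
  ultimately obtain \<alpha> \<beta> where "\<alpha> * x + \<beta> * q = 1" using atom_comaximal[OF q z(2) _ z(3)] by blast
  then have m: "m = m * \<alpha> * x + m * \<beta> * q"
    by (metis distrib_left mult.assoc mult.right_neutral)
  then have "m * \<beta> * q = m - m * \<alpha> * x" by (metis add_diff_cancel_left')
  then have "m * \<beta> * q \<in> left_ideal m" using x by (simp add: left_ideal_diff left_ideal_mult)
  then have "m * \<beta> * q \<in> left_ideal x" using sub by (simp add: left_ideal_mult subset_iff)
  then show ?thesis using m by (metis left_ideal_add left_ideal_mult left_ideal_self)
qed simp

section \<open>Similarity\<close>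

text \<open>The element \<open>c\<close> represents the image of \<open>1\<close> under an isomorphism \<open>R/Ra \<cong> R/Rb\<close>.\<close>

definition similar_via :: "'a::ring_1 \<Rightarrow> 'a \<Rightarrow> 'a \<Rightarrow> bool" where
  "similar_via c a b \<longleftrightarrow> (\<forall>r. r \<in> left_ideal a \<longleftrightarrow> r * c \<in> left_ideal b) \<and> (\<exists>x y. x * c + y * b = 1)"

lemma coset_eq_iff: "x +o left_ideal a = y +o left_ideal a \<longleftrightarrow> x - y \<in> left_ideal a"
proof
  assume "x +o left_ideal a = y +o left_ideal a"
  moreover have "x + 0 \<in> x +o left_ideal a" by (intro set_plus_intro2) simp
  ultimately obtain t where "t \<in> left_ideal a" "x = y + t" by (auto simp: elt_set_plus_def)
  then show "x - y \<in> left_ideal a" by simp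
next
  assume d: "x - y \<in> left_ideal a"
  show "x +o left_ideal a = y +o left_ideal a"
  proof (intro equalityI subsetI)
    fix z assume "z \<in> x +o left_ideal a"
    then have "z = y + ((z - x) + (x - y))" "z - x \<in> left_ideal a" by (auto simp: elt_set_plus_def)
    then show "z \<in> y +o left_ideal a" using left_ideal_add[OF _ d] by (metis set_plus_intro2)
  next
    fix z assume "z \<in> y +o left_ideal a"
    then have "z = x + ((z - y) - (x - y))" "z - y \<in> left_ideal a" by (auto simp: elt_set_plus_def)
    then show "z \<in> x +o left_ideal a" using left_ideal_diff[OF _ d] by (metis set_plus_intro2)
  qed
qed

text \<open>A homomorphism from \<open>R/Ra\<close> is determined by the image of the coset of 1. In
  \<open>similar_via\<close> the equivalence expresses that it is well defined and injective, the
  Bezout relation that it is surjective.\<close>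

lemma quot_iso_iff: "quot_iso (left_ideal a) (left_ideal b) \<longleftrightarrow> (\<exists>c. similar_via c a b)"
proof
  assume "quot_iso (left_ideal a) (left_ideal b)"
  then obtain \<phi> where bij: "bij_betw \<phi> (quot (left_ideal a)) (quot (left_ideal b))"
    and smult: "\<And>r X. X \<in> quot (left_ideal a) \<Longrightarrow>
      \<phi> (quot_smult (left_ideal a) r X) = quot_smult (left_ideal b) r (\<phi> X)"
    unfolding quot_iso_def by blast
  have in_quot: "x +o left_ideal a \<in> quot (left_ideal a)" for x by (auto simp: quot_def)
  from bij in_quot[of 1] have "\<phi> (1 +o left_ideal a) \<in> quot (left_ideal b)"
    by (metis bij_betwE)
  then obtain c where c: "\<phi> (1 +o left_ideal a) = c +o left_ideal b" by (auto simp: quot_def)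
  have \<phi>: "\<phi> (r +o left_ideal a) = (r * c) +o left_ideal b" for r
    using smult[OF in_quot[of 1], of r] by (simp add: quot_smult_left_ideal c)
  have "r \<in> left_ideal a \<longleftrightarrow> r * c \<in> left_ideal b" for r
  proof -
    have "r \<in> left_ideal a \<longleftrightarrow> r +o left_ideal a = 0 +o left_ideal a"
      using coset_eq_iff[of r a 0] by simp
    also have "\<dots> \<longleftrightarrow> \<phi> (r +o left_ideal a) = \<phi> (0 +o left_ideal a)"
      using bij in_quot by (metis bij_betw_imp_inj_on inj_on_eq_iff)
    also have "\<dots> \<longleftrightarrow> r * c \<in> left_ideal b" unfolding \<phi> coset_eq_iff by simp
    finally show ?thesis .
  qed
  moreover have "\<exists>x y. x * c + y * b = 1"
  proof -
    have "1 +o left_ideal b \<in> quot (left_ideal b)" by (auto simp: quot_def)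
    then have "1 +o left_ideal b \<in> \<phi> ` quot (left_ideal a)" using bij by (simp add: bij_betw_def)
    then obtain x where "1 +o left_ideal b = \<phi> (x +o left_ideal a)" by (auto simp: quot_def)
    then have "1 - x * c \<in> left_ideal b" unfolding \<phi> coset_eq_iff .
    then obtain y where "1 - x * c = y * b" by (auto simp: mem_left_ideal)
    then have "x * c + y * b = 1" by (simp add: algebra_simps)
    then show ?thesis by blast
  qed
  ultimately show "\<exists>c. similar_via c a b" unfolding similar_via_def by blast
next
  assume "\<exists>c. similar_via c a b"
  then obtain c where c: "\<And>r. r \<in> left_ideal a \<longleftrightarrow> r * c \<in> left_ideal b"
    and xy: "\<exists>x y. x * c + y * b = 1" unfolding similar_via_def by blast
  \<comment> \<open>Defined on whole cosets, so that no representative is chosen. Adding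
    \<open>Rb\<close> fills \<open>X * c\<close> up to a full coset.\<close>
  define \<phi> where "\<phi> X = {x * c + t | x t. x \<in> X \<and> t \<in> left_ideal b}" for X
  have \<phi>: "\<phi> (r +o left_ideal a) = (r * c) +o left_ideal b" for r
  proof (intro equalityI subsetI)
    fix z assume "z \<in> \<phi> (r +o left_ideal a)"
    then obtain s t where "s \<in> left_ideal a" "t \<in> left_ideal b" "z = (r + s) * c + t"
      by (auto simp: \<phi>_def elt_set_plus_def)
    then have "z = r * c + (s * c + t)" "s * c + t \<in> left_ideal b"
      using c left_ideal_add by (auto simp: distrib_right)
    then show "z \<in> (r * c) +o left_ideal b" by (auto intro: set_plus_intro2)
  next
    fix z assume "z \<in> (r * c) +o left_ideal b"
    then obtain t where "t \<in> left_ideal b" "z = r * c + t" by (auto simp: elt_set_plus_def)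
    moreover have "r \<in> r +o left_ideal a" using set_plus_intro2[of 0 "left_ideal a" r] by simp
    ultimately show "z \<in> \<phi> (r +o left_ideal a)" unfolding \<phi>_def by blast
  qed
  have "bij_betw \<phi> (quot (left_ideal a)) (quot (left_ideal b))"
    unfolding bij_betw_def
  proof (intro conjI equalityI subsetI)
    show "inj_on \<phi> (quot (left_ideal a))"
    proof (rule inj_onI)
      fix X Y assume XY: "X \<in> quot (left_ideal a)" "Y \<in> quot (left_ideal a)" "\<phi> X = \<phi> Y"
      then obtain x y where xy: "X = x +o left_ideal a" "Y = y +o left_ideal a" by (auto simp: quot_def)
      with XY(3) have "x * c - y * c \<in> left_ideal b" by (simp add: \<phi> coset_eq_iff)
      then have "x - y \<in> left_ideal a" by (simp add: c left_diff_distrib)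
      then show "X = Y" unfolding xy coset_eq_iff .
    qed
    show "X \<in> quot (left_ideal b)" if "X \<in> \<phi> ` quot (left_ideal a)" for X
      using that by (auto simp: quot_def \<phi>)
    fix X assume "X \<in> quot (left_ideal b)"
    then obtain r where r: "X = r +o left_ideal b" by (auto simp: quot_def)
    obtain x y where "x * c + y * b = 1" using xy by blast
    then have "r - r * x * c = r * y * b"
      by (metis add_diff_cancel_left' distrib_left mult.assoc mult.right_neutral)
    then have "r - r * x * c \<in> left_ideal b" by (auto simp: mem_left_ideal)
    then have "X = \<phi> ((r * x) +o left_ideal a)" unfolding r \<phi> coset_eq_iff .
    then show "X \<in> \<phi> ` quot (left_ideal a)" by (auto simp: quot_def)
  qed
  moreover have "\<forall>X\<in>quot (left_ideal a). \<forall>Y\<in>quot (left_ideal a). \<phi> (X + Y) = \<phi> X + \<phi> Y"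
    by (auto simp: quot_def quot_add_left_ideal \<phi> distrib_right)
  moreover have "\<forall>r. \<forall>X\<in>quot (left_ideal a).
      \<phi> (quot_smult (left_ideal a) r X) = quot_smult (left_ideal b) r (\<phi> X)"
    by (auto simp: quot_def quot_smult_left_ideal \<phi> mult.assoc)
  ultimately show "quot_iso (left_ideal a) (left_ideal b)" unfolding quot_iso_def by blast
qed

lemma similar_iff: "similar a b \<longleftrightarrow> a \<noteq> 0 \<and> b \<noteq> 0 \<and> (\<exists>c. similar_via c a b)"
  by (simp add: similar_def quot_iso_iff)

section \<open>Similarity as an equivalence relation\<close>

lemma similar_refl: "a \<noteq> 0 \<Longrightarrow> similar a a"
proof -
  have "1 * 1 + 0 * a = 1" by simp
  then have "similar_via 1 a a" unfolding similar_via_def mult_1_right by blast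
  then show "a \<noteq> 0 \<Longrightarrow> similar a a" unfolding similar_iff by blast
qed

text \<open>The inverse isomorphism sends 1 to \<open>x\<close>, because \<open>x * c\<close> is
  congruent to 1 modulo \<open>Rb\<close>.\<close>

lemma similar_sym:
  assumes "similar a b" shows "similar b a"
proof -
  from assms obtain c x y where nz: "a \<noteq> 0" "b \<noteq> 0"
    and c: "\<And>r. r \<in> left_ideal a \<longleftrightarrow> r * c \<in> left_ideal b" and xy: "x * c + y * b = 1"
    unfolding similar_iff similar_via_def by blast
  have xc: "x * c = 1 - y * b" using xy by (simp add: algebra_simps)
  have "r \<in> left_ideal b \<longleftrightarrow> r * x \<in> left_ideal a" for r
  proof -
    have *: "r * x * c = r - r * y * b" by (simp add: mult.assoc xc right_diff_distrib)
    have b: "r * y * b \<in> left_ideal b" by (simp add: left_ideal_mult)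
    have "r \<in> left_ideal b" if "r - r * y * b \<in> left_ideal b"
      using left_ideal_add[OF that b] by simp
    then show ?thesis unfolding c * using left_ideal_diff[OF _ b] by blast
  qed
  moreover have "\<exists>u v. u * x + v * a = 1"
  proof -
    have "(1 - c * x) * c = c * y * b" by (simp add: mult.assoc xc algebra_simps)
    then have "1 - c * x \<in> left_ideal a" unfolding c by (auto simp: mem_left_ideal)
    then obtain v where "1 - c * x = v * a" by (auto simp: mem_left_ideal)
    then have "c * x + v * a = 1" by (simp add: algebra_simps)
    then show ?thesis by blast
  qed
  ultimately show ?thesis using nz unfolding similar_iff similar_via_def by blast
qed

text \<open>The composite isomorphism sends 1 to \<open>c * d\<close>.\<close>

lemma similar_trans:
  assumes "similar a b" "similar b e" shows "similar a e"
proof -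
  from assms(1) obtain c x y where nz: "a \<noteq> 0" "b \<noteq> 0"
    and c: "\<And>r. r \<in> left_ideal a \<longleftrightarrow> r * c \<in> left_ideal b" and xy: "x * c + y * b = 1"
    unfolding similar_iff similar_via_def by blast
  from assms(2) obtain d x' y' where e: "e \<noteq> 0"
    and d: "\<And>r. r \<in> left_ideal b \<longleftrightarrow> r * d \<in> left_ideal e" and xy': "x' * d + y' * e = 1"
    unfolding similar_iff similar_via_def by blast
  have "r \<in> left_ideal a \<longleftrightarrow> r * (c * d) \<in> left_ideal e" for r
    by (simp add: c d flip: mult.assoc)
  moreover have "\<exists>u v. u * (c * d) + v * e = 1"
  proof -
    \<comment> \<open>Right multiplication by \<open>d\<close> maps \<open>Rb\<close> into
      \<open>Re\<close>, which turns the relation modulo \<open>b\<close> into one modulo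
      \<open>e\<close>.\<close>
    obtain w where w: "b * d = w * e" using d[of b] by (auto simp: mem_left_ideal)
    have "x' * (x * c + y * b) * d + y' * e = 1" using xy xy' by simp
    then have "x' * x * (c * d) + x' * y * (b * d) + y' * e = 1" by (simp add: algebra_simps)
    then have "x' * x * (c * d) + (x' * y * w + y') * e = 1" by (simp add: w algebra_simps)
    then show ?thesis by blast
  qed
  ultimately show ?thesis using nz e unfolding similar_iff similar_via_def by blast
qed

lemma similar_imp_sim_class_eq: "similar a b \<Longrightarrow> sim_class a = sim_class b"
  by (auto simp: sim_class_def intro: similar_trans similar_sym)

lemma atom_in_sim_class: "p \<in> atoms \<Longrightarrow> p \<in> sim_class p"
  by (simp add: sim_class_def similar_refl atom_nonzero)

text \<open>Choosing representatives inside \<open>\<Delta>\<close> presents the classes as an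
  image, so they can be counted by image lemmas.\<close>

lemma sim_classes_meeting_eq:
  assumes "\<Delta> \<subseteq> atoms" shows "sim_classes_meeting \<Delta> = sim_class ` \<Delta>"
proof (intro equalityI subsetI)
  fix C assume "C \<in> sim_classes_meeting \<Delta>"
  then obtain a b where "C = sim_class a" "b \<in> \<Delta>" "similar a b"
    by (auto simp: sim_classes_meeting_def sim_class_def)
  then show "C \<in> sim_class ` \<Delta>" using similar_imp_sim_class_eq by blast
next
  fix C assume "C \<in> sim_class ` \<Delta>"
  then show "C \<in> sim_classes_meeting \<Delta>"
    using assms atom_in_sim_class atom_nonzero unfolding sim_classes_meeting_def by blast
qed

text \<open>Let \<open>Rx = Rm \<inter> Rp\<close>. It contains \<open>Rm \<inter> Rq\<close>, so by
  \<open>Int_atom_covered\<close> it lies in \<open>Rq\<close> or equals \<open>Rm\<close>; the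
  latter would put \<open>m\<close> into \<open>Rp\<close>.\<close>

lemma atom_exchange:
  fixes m p q z :: "'a::two_fir"
  assumes p: "p \<in> atoms" and q: "q \<in> atoms"
    and z: "z \<in> left_ideal m" "z \<in> left_ideal q" "z \<noteq> 0"
    and sub: "left_ideal m \<inter> left_ideal q \<subseteq> left_ideal p" and m: "m \<notin> left_ideal p"
  shows "left_ideal m \<inter> left_ideal p \<subseteq> left_ideal q" and "similar p q"
proof -
  have zp: "z \<in> left_ideal p" using z sub by blast
  obtain x where x: "left_ideal m \<inter> left_ideal p = left_ideal x"
    using two_fir_left[OF z(1) zp z(3)] by metis
  have xmp: "x \<in> left_ideal m" "x \<in> left_ideal p" using x left_ideal_self by blast+
  have "m \<notin> left_ideal x" using m xmp left_ideal_subset_iff by blast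
  moreover have "left_ideal m \<inter> left_ideal q \<subseteq> left_ideal x" using x sub by blast
  ultimately have "x \<in> left_ideal q" using Int_atom_covered[OF q z] xmp(1) by blast
  then show sub': "left_ideal m \<inter> left_ideal p \<subseteq> left_ideal q" unfolding x left_ideal_subset_iff .
  have mq: "m \<notin> left_ideal q" using sub m left_ideal_self by blast
  obtain \<alpha> \<beta> where ab: "\<alpha> * m + \<beta> * p = 1" using atom_comaximal[OF p zp z(1,3) m] .
  obtain \<gamma> \<delta> where gd: "\<gamma> * m + \<delta> * q = 1" using atom_comaximal[OF q z(2,1,3) mq] .
  \<comment> \<open>\<open>\<alpha> * m\<close> is an element of \<open>Rm\<close> congruent to 1
    modulo \<open>Rp\<close>. It is the image of 1 under \<open>R/Rp \<cong> Rm/(Rm \<inter> Rp) =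
    Rm/(Rm \<inter> Rq) \<cong> R/Rq\<close>.\<close>
  have am: "\<alpha> * m = 1 - \<beta> * p" using ab by (simp add: algebra_simps)
  have "r \<in> left_ideal p \<longleftrightarrow> r * (\<alpha> * m) \<in> left_ideal q" for r
  proof -
    have eq: "r * (\<alpha> * m) = r - r * \<beta> * p" by (simp add: am right_diff_distrib mult.assoc)
    have "r * (\<alpha> * m) \<in> left_ideal m" by (simp add: left_ideal_mult)
    then have "r * (\<alpha> * m) \<in> left_ideal q \<longleftrightarrow> r - r * \<beta> * p \<in> left_ideal p"
      using sub sub' eq by auto
    also have "r - r * \<beta> * p \<in> left_ideal p \<longleftrightarrow> r \<in> left_ideal p"
      by (metis diff_add_cancel left_ideal_add left_ideal_diff left_ideal_mult left_ideal_self)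
    finally show ?thesis by simp
  qed
  moreover have "\<exists>x y. x * (\<alpha> * m) + y * q = 1"
  proof -
    \<comment> \<open>Modulo \<open>Rq\<close>, \<open>m\<close> is congruent to
      \<open>m * (\<alpha> * m)\<close>, since the difference lies in \<open>Rm \<inter> Rp\<close>.
      Substitution into \<open>\<gamma> * m + \<delta> * q = 1\<close> gives the Bezout
      relation.\<close>
    have eq: "m * \<beta> * p = m - m * \<alpha> * m"
      using ab by (metis add_diff_cancel_left' distrib_left mult.assoc mult.right_neutral)
    have "m * \<beta> * p \<in> left_ideal m" unfolding eq by (simp add: left_ideal_diff left_ideal_mult)
    moreover have "m * \<beta> * p \<in> left_ideal p" by (simp add: left_ideal_mult)
    ultimately have "m * \<beta> * p \<in> left_ideal q" using sub' by blast
    then obtain w where w: "m * \<beta> * p = w * q" unfolding mem_left_ideal by blast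
    have "m = m * (\<alpha> * m) + w * q" using eq w by (simp add: mult.assoc algebra_simps)
    then have "\<gamma> * (m * (\<alpha> * m) + w * q) + \<delta> * q = 1" using gd by simp
    then have "\<gamma> * m * (\<alpha> * m) + (\<gamma> * w + \<delta>) * q = 1" by (simp add: algebra_simps)
    then show ?thesis by blast
  qed
  ultimately show "similar p q"
    using p q atom_nonzero unfolding similar_iff similar_via_def by blast
qed

section \<open>Atomic right factors\<close>

text \<open>Transposition: if \<open>q\<close> is not in \<open>Rp\<close>, write
  \<open>Rq \<inter> Rp = Rc\<close> and \<open>c = p' * q\<close>. Then \<open>Rp'\<close> is the
  annihilator of the coset of \<open>q\<close> in \<open>R/Rp\<close>, and this coset generates
  \<open>R/Rp\<close>. So \<open>p'\<close> is similar to \<open>p\<close>, and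
  \<open>g * q \<in> Rp\<close> puts \<open>g\<close> into \<open>Rp'\<close>.\<close>

lemma atom_right_factor_step:
  fixes g p q :: "'a::two_fir"
  assumes p: "p \<in> atoms" and q: "q \<in> atoms" and g: "g \<noteq> 0" and gq: "g * q \<in> left_ideal p"
  shows "similar p q \<or> (\<exists>p'\<in>atoms. similar p p' \<and> g \<in> left_ideal p')"
proof (cases "q \<in> left_ideal p")
  case True
  then have "p \<in> left_ideal q"
    using atom_left_ideal_maximal[OF q] one_notin_left_ideal_atom[OF p] by blast
  with True have eq: "left_ideal p = left_ideal q" using left_ideal_subset_iff by blast
  have "similar p p" using similar_refl atom_nonzero[OF p] .
  then have "similar p q" using eq atom_nonzero[OF q] unfolding similar_def by metis
  then show ?thesis ..
next
  case False
  have z: "g * q \<in> left_ideal q" "g * q \<noteq> 0" using g q atom_nonzero by (auto simp: left_ideal_mult)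
  obtain \<alpha> \<beta> where ab: "\<alpha> * q + \<beta> * p = 1" using atom_comaximal[OF p gq z False] .
  obtain c where c: "left_ideal q \<inter> left_ideal p = left_ideal c"
    using two_fir_left[OF z(1) gq z(2)] by metis
  then have cq: "c \<in> left_ideal q" "c \<in> left_ideal p" using left_ideal_self by blast+
  then obtain p' where p': "c = p' * q" by (auto simp: mem_left_ideal)
  have q0: "q \<noteq> 0" using q atom_nonzero by blast
  have char: "r \<in> left_ideal p' \<longleftrightarrow> r * q \<in> left_ideal p" for r
  proof -
    have "r * q \<in> left_ideal p \<longleftrightarrow> r * q \<in> left_ideal c" using c by (auto simp: left_ideal_mult)
    also have "\<dots> \<longleftrightarrow> (\<exists>s. r * q = s * p' * q)" by (simp add: mem_left_ideal p' mult.assoc)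
    also have "\<dots> \<longleftrightarrow> r \<in> left_ideal p'" using q0 by (simp add: mem_left_ideal)
    finally show ?thesis by simp
  qed
  have gp': "g \<in> left_ideal p'" using char gq by blast
  then have p'0: "p' \<noteq> 0" using g by (auto simp: mem_left_ideal)
  have "similar p' p" unfolding similar_iff similar_via_def
    using p'0 p atom_nonzero char ab by blast
  moreover have "p' \<in> atoms"
  proof -
    have "1 \<notin> left_ideal p'" unfolding char using False by simp
    moreover have "x \<in> ring_units \<or> y \<in> ring_units" if xy: "p' = x * y" for x y
    proof -
      \<comment> \<open>A factorization \<open>p' = x * y\<close> places \<open>R(y * q)\<close>
        between \<open>Rq \<inter> Rp\<close> and \<open>Rq\<close>, where
        \<open>Int_atom_covered\<close> leaves only the two ends; they make \<open>x\<close> or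
        \<open>y\<close> a unit.\<close>
      have "left_ideal q \<inter> left_ideal p \<subseteq> left_ideal (y * q)" unfolding c left_ideal_subset_iff
        by (auto simp: p' xy mem_left_ideal mult.assoc)
      moreover have "y * q \<in> left_ideal q" by (simp add: left_ideal_mult)
      ultimately consider "y * q \<in> left_ideal p" | "q \<in> left_ideal (y * q)"
        using Int_atom_covered[OF p z(1) gq z(2)] by blast
      then show ?thesis
      proof cases
        case 1
        then have "y \<in> left_ideal p'" using char by blast
        then obtain w where "y = w * (x * y)" unfolding xy mem_left_ideal by blast
        then have "1 * y = (w * x) * y" by (metis mult.assoc mult_1)
        moreover have "y \<noteq> 0" using xy p'0 by auto
        ultimately have "w * x = 1" by (metis mult_right_cancel)
        then show ?thesis using one_sided_unit by blast
      next
        case 2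
        then obtain w where "q = w * (y * q)" unfolding mem_left_ideal by blast
        then have "1 * q = (w * y) * q" by (metis mult.assoc mult_1)
        then have "w * y = 1" using q0 by (metis mult_right_cancel)
        then show ?thesis using one_sided_unit by blast
      qed
    qed
    ultimately show ?thesis using p'0 unfolding atoms_def one_mem_left_ideal_iff by blast
  qed
  ultimately show ?thesis using similar_sym gp' by blast
qed

lemma prod_list_atoms_nonzero:
  fixes qs :: "'a::ring_1_no_zero_divisors list"
  shows "set qs \<subseteq> atoms \<Longrightarrow> prod_list qs \<noteq> 0"
  by (induction qs) (auto dest: atom_nonzero)

text \<open>The factors are passed from the right. Each one is similar to \<open>p\<close> or
  replaces \<open>p\<close> by a similar atom, so the induction has to generalize over
  \<open>p\<close>.\<close>

lemma atom_right_factor_similar: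
  fixes p :: "'a::two_fir"
  assumes "set qs \<subseteq> atoms" "p \<in> atoms" "prod_list qs \<in> left_ideal p"
  shows "\<exists>q\<in>set qs. similar p q"
  using assms
proof (induction qs arbitrary: p rule: rev_induct)
  case Nil
  then show ?case using one_notin_left_ideal_atom by auto
next
  case (snoc q qs)
  then have "prod_list qs \<noteq> 0" using prod_list_atoms_nonzero by auto
  with snoc.prems have "similar p q \<or> (\<exists>p'\<in>atoms. similar p p' \<and> prod_list qs \<in> left_ideal p')"
    by (intro atom_right_factor_step) auto
  then show ?case
  proof
    assume "\<exists>p'\<in>atoms. similar p p' \<and> prod_list qs \<in> left_ideal p'"
    then obtain p' where p': "p' \<in> atoms" "similar p p'" "prod_list qs \<in> left_ideal p'" by blast
    then obtain q' where "q' \<in> set qs" "similar p' q'" using snoc by auto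
    then show ?case using similar_trans[OF p'(2)] by auto
  qed auto
qed

section \<open>The bound on the classes meeting V(f)\<close>

lemma V_unit_empty:
  fixes f :: "'a::ring_1_no_zero_divisors"
  assumes "f \<in> ring_units" shows "V f = {}"
proof -
  have "1 \<in> left_ideal p" if "f \<in> left_ideal p" for p
    using assms that unfolding one_mem_left_ideal_iff[symmetric] using left_ideal_subset_iff by blast
  then show ?thesis unfolding V_def using one_notin_left_ideal_atom by blast
qed

lemma ecard_sim_classes_meeting_V:
  fixes f :: "'a::two_fir"
  assumes "f \<in> fin_length"
  shows "ecard (sim_classes_meeting (V f)) \<le> ell f"
proof (cases "f \<in> ring_units")
  case True
  then show ?thesis by (simp add: V_unit_empty sim_classes_meeting_def ecard_def flip: zero_enat_def)
next
  case False
  with assms have ex: "\<exists>n. atom_product n f" by (auto simp: fin_length_def ell_def split: if_splits)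
  \<comment> \<open>A shortest factorization is taken, so that its number of factors is
    \<open>ell f\<close>.\<close>
  define n where "n = (LEAST n. atom_product n f)"
  have "atom_product n f" unfolding n_def using ex by (rule LeastI_ex)
  then obtain qs where qs: "length qs = n" "set qs \<subseteq> atoms" "prod_list qs = f"
    by (auto simp: atom_product_def)
  have "sim_class ` V f \<subseteq> sim_class ` set qs"
  proof (rule image_subsetI)
    fix p assume "p \<in> V f"
    then obtain q where "q \<in> set qs" "similar p q"
      using atom_right_factor_similar[OF qs(2)] qs(3) unfolding V_def by blast
    then show "sim_class p \<in> sim_class ` set qs" by (simp add: similar_imp_sim_class_eq)
  qed
  moreover have "sim_classes_meeting (V f) = sim_class ` V f"
    by (rule sim_classes_meeting_eq) (auto simp: V_def)
  ultimately have sub: "sim_classes_meeting (V f) \<subseteq> sim_class ` set qs" by simp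
  then have "finite (sim_classes_meeting (V f))" by (rule finite_subset) simp
  moreover have "card (sim_classes_meeting (V f)) \<le> n"
    using card_mono[OF _ sub] card_image_le[of "set qs" sim_class] card_length[of qs] qs(1) by simp
  ultimately show ?thesis using False ex by (simp add: ecard_def ell_def n_def)
qed

section \<open>Dependence of atoms\<close>

text \<open>The closure operator behind \<open>F_dependent\<close> on atoms, with inclusion in place
  of failing comaximality. Without the conditions on F-algebraicity it is monotone and transitive
  over any ring.\<close>

definition atom_span :: "'a::ring_1 set \<Rightarrow> 'a set" where
  "atom_span S = {p \<in> atoms. \<exists>\<Gamma>. finite \<Gamma> \<and> \<Gamma> \<subseteq> S \<and> (\<Inter>\<gamma>\<in>\<Gamma>. left_ideal \<gamma>) \<subseteq> left_ideal p}"

lemma atom_span_superset: "S \<subseteq> atoms \<Longrightarrow> S \<subseteq> atom_span S"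
proof
  fix p assume "S \<subseteq> atoms" "p \<in> S"
  then show "p \<in> atom_span S" unfolding atom_span_def by (auto intro!: exI[of _ "{p}"])
qed

lemma atom_span_mono: "S \<subseteq> T \<Longrightarrow> atom_span S \<subseteq> atom_span T"
  unfolding atom_span_def by blast

lemma atom_span_trans:
  assumes "T \<subseteq> atom_span S" shows "atom_span T \<subseteq> atom_span S"
proof
  fix p assume "p \<in> atom_span T"
  then obtain \<Gamma> where p: "p \<in> atoms" and \<Gamma>: "finite \<Gamma>" "\<Gamma> \<subseteq> T" "(\<Inter>\<gamma>\<in>\<Gamma>. left_ideal \<gamma>) \<subseteq> left_ideal p"
    by (auto simp: atom_span_def)
  have "\<forall>\<gamma>\<in>\<Gamma>. \<exists>\<Lambda>. finite \<Lambda> \<and> \<Lambda> \<subseteq> S \<and> (\<Inter>\<xi>\<in>\<Lambda>. left_ideal \<xi>) \<subseteq> left_ideal \<gamma>"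
    using assms \<Gamma>(2) unfolding atom_span_def by blast
  from bchoice[OF this] obtain \<Lambda> where \<Lambda>: "\<forall>\<gamma>\<in>\<Gamma>. finite (\<Lambda> \<gamma>) \<and> \<Lambda> \<gamma> \<subseteq> S \<and> (\<Inter>\<xi>\<in>\<Lambda> \<gamma>. left_ideal \<xi>) \<subseteq> left_ideal \<gamma>" ..
  have "(\<Inter>\<xi>\<in>(\<Union>\<gamma>\<in>\<Gamma>. \<Lambda> \<gamma>). left_ideal \<xi>) \<subseteq> (\<Inter>\<gamma>\<in>\<Gamma>. left_ideal \<gamma>)"
  proof (intro subsetI INT_I)
    fix x \<gamma> assume x: "x \<in> (\<Inter>\<xi>\<in>(\<Union>\<gamma>\<in>\<Gamma>. \<Lambda> \<gamma>). left_ideal \<xi>)" and \<gamma>: "\<gamma> \<in> \<Gamma>"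
    from x \<gamma> have "x \<in> (\<Inter>\<xi>\<in>\<Lambda> \<gamma>. left_ideal \<xi>)" by blast
    with \<Lambda> \<gamma> show "x \<in> left_ideal \<gamma>" by (meson subsetD)
  qed
  with \<Gamma>(3) have "(\<Inter>\<xi>\<in>(\<Union>\<gamma>\<in>\<Gamma>. \<Lambda> \<gamma>). left_ideal \<xi>) \<subseteq> left_ideal p" by (rule subset_trans[rotated])
  moreover have "finite (\<Union>\<gamma>\<in>\<Gamma>. \<Lambda> \<gamma>)" "(\<Union>\<gamma>\<in>\<Gamma>. \<Lambda> \<gamma>) \<subseteq> S" using \<Gamma>(1) \<Lambda> by auto
  ultimately show "p \<in> atom_span S" unfolding atom_span_def using p by blast
qed

text \<open>One common multiple \<open>f\<close> serves all subsets of \<open>S\<close> at once and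
  provides the nonzero element that \<open>two_fir_left\<close> asks for.\<close>

lemma F_algebraic_atoms_iff:
  fixes S :: "'a::ring_1 set"
  shows "F_algebraic S \<and> S \<subseteq> atoms \<longleftrightarrow> (\<exists>f. f \<noteq> 0 \<and> S \<subseteq> V f)"
proof
  assume *: "F_algebraic S \<and> S \<subseteq> atoms"
  have "0 \<in> (\<Inter>\<delta>\<in>S. left_ideal \<delta>)" by simp
  moreover have "(\<Inter>\<delta>\<in>S. left_ideal \<delta>) \<noteq> {0}" using * by (simp add: F_algebraic_def)
  ultimately obtain f where "f \<noteq> 0" "f \<in> (\<Inter>\<delta>\<in>S. left_ideal \<delta>)" by blast
  then show "\<exists>f. f \<noteq> 0 \<and> S \<subseteq> V f" using * by (auto simp: V_def)
next
  assume "\<exists>f. f \<noteq> 0 \<and> S \<subseteq> V f"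
  then obtain f where "f \<noteq> 0" "f \<in> (\<Inter>\<delta>\<in>S. left_ideal \<delta>)" "S \<subseteq> atoms" by (auto simp: V_def)
  moreover from this have "S \<subseteq> fin_length - ring_units" using atom_in_fin_length atom_not_unit by blast
  ultimately show "F_algebraic S \<and> S \<subseteq> atoms" unfolding F_algebraic_def by blast
qed

text \<open>\<open>f\<close> lies in every partial intersection, so each binary intersection is
  nonzero and the 2-fir property applies.\<close>

lemma Inter_left_ideals_principal:
  fixes f :: "'a::two_fir"
  assumes f: "f \<noteq> 0" and fin: "finite \<Gamma>" and sub: "\<Gamma> \<subseteq> V f"
  shows "\<exists>m. f \<in> left_ideal m \<and> (\<Inter>\<gamma>\<in>\<Gamma>. left_ideal \<gamma>) = left_ideal m"
  using fin sub
proof (induction \<Gamma>)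
  case empty
  have "left_ideal (1::'a) = UNIV" by (auto simp: mem_left_ideal)
  then show ?case by (intro exI[of _ 1]) simp
next
  case (insert \<gamma> \<Gamma>)
  then obtain m where m: "f \<in> left_ideal m" "(\<Inter>\<gamma>\<in>\<Gamma>. left_ideal \<gamma>) = left_ideal m" by auto
  have "f \<in> left_ideal \<gamma>" using insert.prems by (auto simp: V_def)
  then show ?case using two_fir_left[OF _ m(1) f, of \<gamma>] m by (metis IntI INT_insert)
qed

text \<open>The finite intersection is some \<open>Rm\<close>, and for an atom \<open>p\<close>
  either \<open>m \<in> Rp\<close> or \<open>Rp + Rm = R\<close>.\<close>

lemma F_dependent_iff:
  fixes f p :: "'a::two_fir"
  assumes f: "f \<noteq> 0" and S: "S \<subseteq> V f" and p: "p \<in> atoms"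
  shows "F_dependent p S \<longleftrightarrow> p \<in> atom_span S"
proof
  assume "F_dependent p S"
  then obtain \<Gamma> where alg: "F_algebraic (S \<union> {p})" and \<Gamma>: "finite \<Gamma>" "\<Gamma> \<subseteq> S"
    and ne: "left_ideal p + (\<Inter>\<gamma>\<in>\<Gamma>. left_ideal \<gamma>) \<noteq> UNIV" unfolding F_dependent_def by blast
  have "S \<union> {p} \<subseteq> atoms" using S p by (auto simp: V_def)
  \<comment> \<open>\<open>f\<close> need not lie in \<open>Rp\<close>, so a common multiple of
    \<open>S\<close> and \<open>p\<close> takes its place.\<close>
  with alg obtain z where z: "z \<noteq> 0" "S \<union> {p} \<subseteq> V z" using F_algebraic_atoms_iff by blast
  then obtain m where m: "z \<in> left_ideal m" "(\<Inter>\<gamma>\<in>\<Gamma>. left_ideal \<gamma>) = left_ideal m"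
    using Inter_left_ideals_principal[OF z(1) \<Gamma>(1)] \<Gamma>(2) by blast
  have "m \<in> left_ideal p"
  proof (rule ccontr)
    assume "m \<notin> left_ideal p"
    moreover have "z \<in> left_ideal p" using z by (auto simp: V_def)
    ultimately obtain \<alpha> \<beta> where ab: "\<alpha> * m + \<beta> * p = 1" using atom_comaximal[OF p _ m(1) z(1)] by blast
    have "x \<in> left_ideal p + left_ideal m" for x
    proof -
      have "x = x * (\<alpha> * m + \<beta> * p)" by (simp add: ab)
      then have "x = x * \<beta> * p + x * \<alpha> * m" by (simp add: algebra_simps)
      then show ?thesis unfolding mem_sum_left_ideals by blast
    qed
    then show False using ne m(2) by auto
  qed
  then have "(\<Inter>\<gamma>\<in>\<Gamma>. left_ideal \<gamma>) \<subseteq> left_ideal p" unfolding m(2) left_ideal_subset_iff .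
  then show "p \<in> atom_span S" using p \<Gamma> by (auto simp: atom_span_def)
next
  assume "p \<in> atom_span S"
  then obtain \<Gamma> where \<Gamma>: "finite \<Gamma>" "\<Gamma> \<subseteq> S" "(\<Inter>\<gamma>\<in>\<Gamma>. left_ideal \<gamma>) \<subseteq> left_ideal p"
    by (auto simp: atom_span_def)
  \<comment> \<open>Here \<open>f\<close> lies in \<open>Rp\<close> as well and witnesses that
    \<open>S \<union> {p}\<close> is F-algebraic.\<close>
  have "f \<in> (\<Inter>\<gamma>\<in>\<Gamma>. left_ideal \<gamma>)" using S \<Gamma>(2) by (auto simp: V_def)
  then have "S \<union> {p} \<subseteq> V f" using S \<Gamma>(3) p by (auto simp: V_def)
  then have "F_algebraic (S \<union> {p})" "F_algebraic S" using F_algebraic_atoms_iff f S by blast+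
  moreover have "left_ideal p + (\<Inter>\<gamma>\<in>\<Gamma>. left_ideal \<gamma>) \<subseteq> left_ideal p"
    using \<Gamma>(3) left_ideal_add by (auto simp: set_plus_def)
  then have "left_ideal p + (\<Inter>\<gamma>\<in>\<Gamma>. left_ideal \<gamma>) \<noteq> UNIV"
    using one_notin_left_ideal_atom[OF p] by blast
  ultimately show "F_dependent p S" unfolding F_dependent_def
    using atom_in_fin_length[OF p] \<Gamma> by blast
qed

lemma F_closure_eq_atom_span:
  fixes f :: "'a::two_fir"
  assumes "f \<noteq> 0" "S \<subseteq> V f" shows "F_closure S = atom_span S"
  using F_dependent_iff[OF assms] by (auto simp: F_closure_def atom_span_def)

section \<open>Exchange property and splitting along similarity classes\<close>

text \<open>Without \<open>q\<close>, the witness for \<open>p\<close> has an intersection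
  \<open>Rm\<close> not contained in \<open>Rp\<close>. So \<open>atom_exchange\<close> applies and
  yields the similarity along with the exchange.\<close>

lemma atom_span_exchange:
  fixes f :: "'a::two_fir"
  assumes f: "f \<noteq> 0" and S: "insert q S \<subseteq> V f"
    and p: "p \<in> atom_span (insert q S)" "p \<notin> atom_span S"
  shows "q \<in> atom_span (insert p S)" and "similar p q"
proof -
  from p obtain \<Gamma> where pa: "p \<in> atoms" and \<Gamma>: "finite \<Gamma>" "\<Gamma> \<subseteq> insert q S" "(\<Inter>\<gamma>\<in>\<Gamma>. left_ideal \<gamma>) \<subseteq> left_ideal p"
    by (auto simp: atom_span_def)
  have q: "q \<in> atoms" "f \<in> left_ideal q" using S by (auto simp: V_def)
  define \<Gamma>' where "\<Gamma>' = \<Gamma> - {q}"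
  have \<Gamma>': "finite \<Gamma>'" "\<Gamma>' \<subseteq> S" "\<Gamma>' \<subseteq> V f" using \<Gamma> S by (auto simp: \<Gamma>'_def)
  obtain m where m: "f \<in> left_ideal m" "(\<Inter>\<gamma>\<in>\<Gamma>'. left_ideal \<gamma>) = left_ideal m"
    using Inter_left_ideals_principal[OF f \<Gamma>'(1,3)] by blast
  have "left_ideal m \<inter> left_ideal q \<subseteq> (\<Inter>\<gamma>\<in>\<Gamma>. left_ideal \<gamma>)" unfolding m(2)[symmetric] by (auto simp: \<Gamma>'_def)
  then have sub: "left_ideal m \<inter> left_ideal q \<subseteq> left_ideal p" using \<Gamma>(3) by blast
  have "m \<notin> left_ideal p"
  proof
    assume "m \<in> left_ideal p"
    then have "(\<Inter>\<gamma>\<in>\<Gamma>'. left_ideal \<gamma>) \<subseteq> left_ideal p" unfolding m(2) left_ideal_subset_iff .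
    then show False using p(2) pa \<Gamma>' by (auto simp: atom_span_def)
  qed
  note ex = atom_exchange[OF pa q(1) m(1) q(2) f sub this]
  show "similar p q" by (fact ex(2))
  have "(\<Inter>\<gamma>\<in>insert p \<Gamma>'. left_ideal \<gamma>) \<subseteq> left_ideal q" using ex(1) m(2) by auto
  then show "q \<in> atom_span (insert p S)"
    unfolding atom_span_def using q(1) \<Gamma>' by (blast intro: finite.insertI)
qed

text \<open>Members of \<open>\<Gamma>\<close> outside the class of \<open>p\<close> are removed one
  at a time: if removing \<open>q\<close> destroyed the dependence, exchange would make
  \<open>q\<close> similar to \<open>p\<close>.\<close>

lemma atom_span_sim_class:
  fixes f :: "'a::two_fir"
  assumes f: "f \<noteq> 0" and S: "S \<subseteq> V f" and p: "p \<in> atom_span S"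
  shows "p \<in> atom_span (S \<inter> sim_class p)"
proof -
  from p obtain \<Gamma> where pa: "p \<in> atoms" and \<Gamma>: "finite \<Gamma>" "\<Gamma> \<subseteq> S" "(\<Inter>\<gamma>\<in>\<Gamma>. left_ideal \<gamma>) \<subseteq> left_ideal p"
    by (auto simp: atom_span_def)
  have drop: "p \<in> atom_span (\<Gamma> \<inter> sim_class p)"
    if "finite \<Lambda>" "p \<in> atom_span (\<Lambda> \<union> (\<Gamma> \<inter> sim_class p))" "\<Lambda> \<subseteq> \<Gamma> - sim_class p" for \<Lambda>
    using that
  proof (induction \<Lambda>)
    case empty
    then show ?case by simp
  next
    case (insert q \<Lambda>)
    let ?T = "\<Lambda> \<union> (\<Gamma> \<inter> sim_class p)"
    have "insert q ?T \<subseteq> V f" using insert.prems \<Gamma>(2) S by auto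
    moreover have "\<not> similar p q" using insert.prems by (auto simp: sim_class_def)
    ultimately have "p \<in> atom_span ?T"
      using atom_span_exchange(2)[OF f, of q ?T p] insert.prems(1) by (metis Un_insert_left)
    then show ?case using insert by auto
  qed
  have "p \<in> atom_span \<Gamma>" unfolding atom_span_def using pa \<Gamma> by blast
  moreover have "(\<Gamma> - sim_class p) \<union> (\<Gamma> \<inter> sim_class p) = \<Gamma>" by blast
  ultimately have "p \<in> atom_span (\<Gamma> \<inter> sim_class p)"
    using drop[of "\<Gamma> - sim_class p"] \<Gamma>(1) by simp
  then show ?thesis using atom_span_mono[of "\<Gamma> \<inter> sim_class p" "S \<inter> sim_class p"] \<Gamma>(2) by blast
qed

lemma atom_span_similar:
  fixes f :: "'a::two_fir"
  assumes "f \<noteq> 0" "S \<subseteq> V f" "p \<in> atom_span S"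
  shows "\<exists>q\<in>S. similar p q"
proof (rule ccontr)
  assume "\<not> ?thesis"
  then have "S \<inter> sim_class p = {}" by (auto simp: sim_class_def)
  then have "p \<in> atom_span {}" using atom_span_sim_class[OF assms] by simp
  \<comment> \<open>The empty intersection is \<open>R\<close>, which is not contained in
    \<open>Rp\<close>.\<close>
  then show False using one_notin_left_ideal_atom by (auto simp: atom_span_def)
qed

section \<open>Bases\<close>

definition atom_indep :: "'a::ring_1 set \<Rightarrow> bool" where
  "atom_indep B \<longleftrightarrow> (\<forall>b\<in>B. b \<notin> atom_span (B - {b}))"

lemma atom_indep_subset: "atom_indep B \<Longrightarrow> A \<subseteq> B \<Longrightarrow> atom_indep A"
  unfolding atom_indep_def using atom_span_mono[of "A - {_}" "B - {_}"] by blast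

text \<open>If some \<open>b\<close> in \<open>J\<close> depended on \<open>a\<close> and
  \<open>J - {b}\<close>, exchange would make \<open>a\<close> dependent on
  \<open>J\<close>.\<close>

lemma atom_indep_insert:
  fixes f :: "'a::two_fir"
  assumes f: "f \<noteq> 0" and sub: "insert a J \<subseteq> V f" and J: "atom_indep J" and a: "a \<notin> atom_span J"
  shows "atom_indep (insert a J)"
  unfolding atom_indep_def
proof
  fix b assume b: "b \<in> insert a J"
  show "b \<notin> atom_span (insert a J - {b})"
  proof (cases "b = a")
    case True
    then show ?thesis using a atom_span_mono[of "insert a J - {b}" J] by blast
  next
    case False
    then have eq: "insert a J - {b} = insert a (J - {b})" "insert b (J - {b}) = J" using b by auto
    have "b \<notin> atom_span (J - {b})" using J b False by (auto simp: atom_indep_def)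
    moreover have "insert a (J - {b}) \<subseteq> V f" using sub by blast
    ultimately show ?thesis using atom_span_exchange(1)[OF f] a eq by metis
  qed
qed

lemma F_basis_iff:
  fixes f :: "'a::two_fir"
  assumes f: "f \<noteq> 0" and \<Delta>: "\<Delta> \<subseteq> V f"
  shows "F_basis B \<Delta> \<longleftrightarrow> B \<subseteq> \<Delta> \<and> atom_indep B \<and> \<Delta> \<subseteq> atom_span B"
proof -
  have alg: "F_algebraic S" if "S \<subseteq> \<Delta>" for S using F_algebraic_atoms_iff f \<Delta> that by blast
  have dep: "F_dependent p S \<longleftrightarrow> p \<in> atom_span S" if "S \<subseteq> \<Delta>" "p \<in> \<Delta>" for p S
    by (rule F_dependent_iff[OF f]) (use that \<Delta> in \<open>auto simp: V_def\<close>)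
  have "F_independent B \<longleftrightarrow> atom_indep B" if B: "B \<subseteq> \<Delta>"
  proof -
    have "F_dependent b (B - {b}) \<longleftrightarrow> b \<in> atom_span (B - {b})" if "b \<in> B" for b
      using B that by (intro dep) auto
    then show ?thesis using alg[OF B] by (auto simp: F_independent_def atom_indep_def)
  qed
  moreover have "(\<forall>\<delta>\<in>\<Delta>. F_dependent \<delta> B) \<longleftrightarrow> \<Delta> \<subseteq> atom_span B" if "B \<subseteq> \<Delta>"
    using dep[OF that] by blast
  ultimately show ?thesis unfolding F_basis_def using alg by blast
qed

text \<open>By Zorn's lemma there is a maximal independent subset; it spans because
  \<open>atom_indep_insert\<close> would enlarge it otherwise. Existence ensures that the set chosen
  by \<open>SOME\<close> in \<open>rk\<close> is a basis.\<close>

lemma F_basis_exists: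
  fixes f :: "'a::two_fir"
  assumes f: "f \<noteq> 0" and \<Delta>: "\<Delta> \<subseteq> V f"
  shows "\<exists>B. F_basis B \<Delta>"
proof -
  define \<I> where "\<I> = {B. B \<subseteq> \<Delta> \<and> atom_indep B}"
  have "\<Union>\<C> \<in> \<I>" if \<C>: "subset.chain \<I> \<C>" for \<C>
  proof -
    have sub: "\<C> \<subseteq> \<I>" using \<C> by (auto simp: subset_chain_def)
    have "atom_indep (\<Union>\<C>)" unfolding atom_indep_def
    proof (intro ballI notI)
      fix b assume b: "b \<in> \<Union>\<C>" "b \<in> atom_span (\<Union>\<C> - {b})"
      then obtain \<Gamma> where ba: "b \<in> atoms" and \<Gamma>: "finite \<Gamma>" "\<Gamma> \<subseteq> \<Union>\<C> - {b}"
        "(\<Inter>\<gamma>\<in>\<Gamma>. left_ideal \<gamma>) \<subseteq> left_ideal b" unfolding atom_span_def by blast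
      \<comment> \<open>A dependence has a finite witness, which already lies in one member of the
        chain.\<close>
      have "finite (insert b \<Gamma>)" "insert b \<Gamma> \<subseteq> \<Union>\<C>" "\<C> \<noteq> {}" using b \<Gamma> by auto
      then obtain A where A: "A \<in> \<C>" "insert b \<Gamma> \<subseteq> A"
        using finite_subset_Union_chain[OF _ _ _ \<C>] by metis
      then have "b \<in> atom_span (A - {b})" unfolding atom_span_def using ba \<Gamma> by blast
      then show False using A sub by (auto simp: \<I>_def atom_indep_def)
    qed
    then show ?thesis using sub by (auto simp: \<I>_def)
  qed
  then obtain B where B: "B \<in> \<I>" and max: "\<And>X. X \<in> \<I> \<Longrightarrow> B \<subseteq> X \<Longrightarrow> X = B"
    using subset_Zorn'[of \<I>] by blast
  have "\<delta> \<in> atom_span B" if \<delta>: "\<delta> \<in> \<Delta>" for \<delta>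
  proof (rule ccontr)
    assume n: "\<delta> \<notin> atom_span B"
    have BD: "insert \<delta> B \<subseteq> \<Delta>" "atom_indep B" using B \<delta> by (auto simp: \<I>_def)
    then have "insert \<delta> B \<in> \<I>" using atom_indep_insert[OF f _ BD(2) n] \<Delta> by (auto simp: \<I>_def)
    then have "\<delta> \<in> B" using max by blast
    moreover have "B \<subseteq> atoms" using BD \<Delta> by (auto simp: V_def)
    ultimately show False using n atom_span_superset by blast
  qed
  then show ?thesis using B F_basis_iff[OF f \<Delta>] by (auto simp: \<I>_def)
qed

section \<open>Invariance of the rank\<close>

text \<open>Steinitz replacement: an element of \<open>I\<close> outside \<open>A\<close> is
  exchanged for one of \<open>A\<close>, which keeps the size and lowers the number of elements
  outside \<open>A\<close>.\<close>

lemma card_atom_indep_le: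
  fixes f :: "'a::two_fir"
  assumes f: "f \<noteq> 0" and A: "finite A" "A \<subseteq> V f"
    and I: "finite I" "I \<subseteq> V f" "atom_indep I" "I \<subseteq> atom_span A"
  shows "card I \<le> card A"
  using I
proof (induction "card (I - A)" arbitrary: I)
  case 0
  then show ?case using A by (intro card_mono) auto
next
  case (Suc k)
  then obtain x where x: "x \<in> I" "x \<notin> A" by (metis Diff_iff card.empty equals0I nat.distinct(1))
  define J where "J = I - {x}"
  have J: "atom_indep J" "J \<subseteq> V f" "J \<subseteq> atom_span A" "finite J"
    using Suc.prems atom_indep_subset[of I J] by (auto simp: J_def)
  have "x \<notin> atom_span J" using Suc.prems x by (auto simp: atom_indep_def J_def)
  \<comment> \<open>Otherwise \<open>x \<in> atom_span A \<subseteq> atom_span J\<close>, against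
    the independence of \<open>I\<close>.\<close>
  then have "\<not> A \<subseteq> atom_span J" using atom_span_trans[of A J] Suc.prems x by blast
  then obtain a where a: "a \<in> A" "a \<notin> atom_span J" by blast
  have atomsVf: "V f \<subseteq> atoms" by (auto simp: V_def)
  have aJ: "a \<notin> J" using a atom_span_superset[of J] J(2) atomsVf by blast
  have "card (insert a J - A) = k"
  proof -
    have "insert a J - A = (I - A) - {x}" using a by (auto simp: J_def)
    then show ?thesis using Suc x by simp
  qed
  moreover have "atom_indep (insert a J)"
    using atom_indep_insert[OF f _ J(1) a(2)] J(2) a(1) A(2) by blast
  moreover have "insert a J \<subseteq> atom_span A"
    using J(3) a(1) atom_span_superset[of A] A(2) atomsVf by blast
  ultimately have "card (insert a J) \<le> card A"
    using Suc.hyps(1)[of "insert a J"] J a(1) A(2) by auto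
  moreover have "card (insert a J) = card I"
    using aJ J(4) x Suc.prems(1) card_Suc_Diff1[of I x] by (simp add: J_def)
  ultimately show ?case by simp
qed

text \<open>Supplies the finiteness needed to compare a finite basis with the one chosen by
  \<open>SOME\<close> in \<open>rk\<close>.\<close>

lemma finite_atom_indep:
  fixes f :: "'a::two_fir"
  assumes f: "f \<noteq> 0" and A: "finite A" "A \<subseteq> V f"
    and I: "I \<subseteq> V f" "atom_indep I" "I \<subseteq> atom_span A"
  shows "finite I"
proof (rule ccontr)
  assume "infinite I"
  then obtain J where J: "J \<subseteq> I" "finite J" "card J = Suc (card A)"
    by (metis infinite_arbitrarily_large)
  have "card J \<le> card A"
    using card_atom_indep_le[OF f A J(2)] J(1) I atom_indep_subset[OF I(2) J(1)] by blast
  then show False using J(3) by simp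
qed

lemma rk_eq_card:
  fixes f :: "'a::two_fir"
  assumes f: "f \<noteq> 0" and \<Delta>: "\<Delta> \<subseteq> V f" and B: "F_basis B \<Delta>" "finite B"
  shows "rk \<Delta> = enat (card B)"
proof -
  define B' where "B' = (SOME B. F_basis B \<Delta>)"
  have "F_basis B' \<Delta>" unfolding B'_def using B(1) by (rule someI)
  then have B': "B' \<subseteq> \<Delta>" "atom_indep B'" "\<Delta> \<subseteq> atom_span B'" using F_basis_iff[OF f \<Delta>] by auto
  have B0: "B \<subseteq> \<Delta>" "atom_indep B" "\<Delta> \<subseteq> atom_span B" using B F_basis_iff[OF f \<Delta>] by auto
  have V: "B \<subseteq> V f" "B' \<subseteq> V f" using B0 B' \<Delta> by auto
  have span: "B \<subseteq> atom_span B'" "B' \<subseteq> atom_span B" using B0 B' by auto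
  have fin: "finite B'" by (rule finite_atom_indep[OF f B(2) V(1) V(2) B'(2) span(2)])
  have "card B' = card B"
    using card_atom_indep_le[OF f B(2) V(1) fin V(2) B'(2) span(2)]
      card_atom_indep_le[OF f fin V(2) B(2) V(1) B0(2) span(1)] by simp
  then show ?thesis using fin by (simp add: rk_def ecard_def flip: B'_def)
qed

section \<open>Bases and closures along similarity classes\<close>

text \<open>By \<open>atom_span_sim_class\<close>, an element of \<open>\<Delta>\<close> depends on
  those members of \<open>B\<close> that lie in its own class.\<close>

lemma F_basis_Int_sim_class:
  fixes f :: "'a::two_fir"
  assumes f: "f \<noteq> 0" and \<Delta>: "\<Delta> \<subseteq> V f" and B: "F_basis B \<Delta>"
  shows "F_basis (B \<inter> sim_class q) (\<Delta> \<inter> sim_class q)"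
proof -
  have B0: "B \<subseteq> \<Delta>" "atom_indep B" "\<Delta> \<subseteq> atom_span B" using B F_basis_iff[OF f \<Delta>] by auto
  have "\<delta> \<in> atom_span (B \<inter> sim_class q)" if "\<delta> \<in> \<Delta>" "\<delta> \<in> sim_class q" for \<delta>
  proof -
    have "sim_class \<delta> = sim_class q"
      using that(2) similar_imp_sim_class_eq[of q \<delta>] by (auto simp: sim_class_def)
    moreover have "\<delta> \<in> atom_span (B \<inter> sim_class \<delta>)"
      by (rule atom_span_sim_class[OF f]) (use B0 \<Delta> that in auto)
    ultimately show ?thesis by simp
  qed
  moreover have "\<Delta> \<inter> sim_class q \<subseteq> V f" using \<Delta> by blast
  ultimately show ?thesis using B0 atom_indep_subset[OF B0(2)] by (subst F_basis_iff[OF f]) auto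
qed

lemma F_basis_UN_sim_class:
  fixes f :: "'a::two_fir"
  assumes f: "f \<noteq> 0" and \<Delta>: "\<Delta> \<subseteq> V f"
    and nsim: "\<And>i j. i \<in> I \<Longrightarrow> j \<in> I \<Longrightarrow> i \<noteq> j \<Longrightarrow> \<not> similar (p i) (p j)"
    and cover: "\<Delta> = (\<Union>i\<in>I. \<Delta> \<inter> sim_class (p i))"
    and B: "\<And>i. i \<in> I \<Longrightarrow> F_basis (B i) (\<Delta> \<inter> sim_class (p i))"
  shows "F_basis (\<Union>i\<in>I. B i) \<Delta>"
proof -
  let ?B = "\<Union>i\<in>I. B i"
  have Bi: "B i \<subseteq> \<Delta> \<inter> sim_class (p i)" "atom_indep (B i)" "\<Delta> \<inter> sim_class (p i) \<subseteq> atom_span (B i)"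
    if "i \<in> I" for i
  proof -
    have "\<Delta> \<inter> sim_class (p i) \<subseteq> V f" using \<Delta> by blast
    from F_basis_iff[OF f this] B[OF that]
    show "B i \<subseteq> \<Delta> \<inter> sim_class (p i)" "atom_indep (B i)" "\<Delta> \<inter> sim_class (p i) \<subseteq> atom_span (B i)"
      by auto
  qed
  have sub: "?B \<subseteq> \<Delta>" using Bi(1) by blast
  have "atom_indep ?B" unfolding atom_indep_def
  proof (intro ballI notI)
    fix b assume b: "b \<in> ?B" "b \<in> atom_span (?B - {b})"
    then obtain i where i: "i \<in> I" "b \<in> B i" by blast
    then have bi: "similar (p i) b" using Bi(1)[OF i(1)] by (auto simp: sim_class_def)
    have "?B - {b} \<subseteq> V f" using sub \<Delta> by blast
    from atom_span_sim_class[OF f this b(2)]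
    have "b \<in> atom_span ((?B - {b}) \<inter> sim_class b)" .
    \<comment> \<open>Different \<open>p i\<close> are not similar, so every member of the union
      that is similar to \<open>b\<close> comes from \<open>B i\<close>.\<close>
    moreover have "(?B - {b}) \<inter> sim_class b \<subseteq> B i - {b}"
    proof
      fix c assume c: "c \<in> (?B - {b}) \<inter> sim_class b"
      then obtain j where j: "j \<in> I" "c \<in> B j" by blast
      then have "similar (p j) c" using Bi(1)[OF j(1)] by (auto simp: sim_class_def)
      moreover have "similar (p i) c" using bi c similar_trans by (auto simp: sim_class_def)
      ultimately have "similar (p i) (p j)" using similar_trans similar_sym by blast
      then show "c \<in> B i - {b}" using nsim i(1) j c by blast
    qed
    ultimately have "b \<in> atom_span (B i - {b})" using atom_span_mono by blast
    then show False using Bi(2)[OF i(1)] i(2) by (auto simp: atom_indep_def)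
  qed
  moreover have "\<Delta> \<subseteq> atom_span ?B"
  proof
    fix \<delta> assume "\<delta> \<in> \<Delta>"
    then obtain i where "i \<in> I" "\<delta> \<in> \<Delta> \<inter> sim_class (p i)" using cover by blast
    then show "\<delta> \<in> atom_span ?B" using Bi(3) atom_span_mono[of "B i" ?B] by blast
  qed
  ultimately show ?thesis using F_basis_iff[OF f \<Delta>] sub by blast
qed

text \<open>An atom dependent on \<open>\<Delta>\<close> may lie outside \<open>\<Delta>\<close>,
  but it is similar to a member of \<open>\<Delta>\<close> and so belongs to one of the given
  classes.\<close>

lemma F_closure_UN_sim_class:
  fixes f :: "'a::two_fir"
  assumes f: "f \<noteq> 0" and \<Delta>: "\<Delta> \<subseteq> V f" and cover: "\<Delta> = (\<Union>i\<in>I. \<Delta> \<inter> sim_class (p i))"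
  shows "F_closure \<Delta> = (\<Union>i\<in>I. F_closure (\<Delta> \<inter> sim_class (p i)))"
proof -
  have *: "F_closure (\<Delta> \<inter> sim_class (p i)) = atom_span (\<Delta> \<inter> sim_class (p i))" for i
    using \<Delta> by (intro F_closure_eq_atom_span[OF f]) blast
  have "atom_span \<Delta> \<subseteq> (\<Union>i\<in>I. atom_span (\<Delta> \<inter> sim_class (p i)))"
  proof
    fix x assume x: "x \<in> atom_span \<Delta>"
    then obtain \<delta> where "\<delta> \<in> \<Delta>" "similar x \<delta>" using atom_span_similar[OF f \<Delta>] by blast
    moreover from this obtain i where i: "i \<in> I" "similar (p i) \<delta>"
      using cover by (auto simp: sim_class_def)
    ultimately have "sim_class x = sim_class (p i)" by (simp add: similar_imp_sim_class_eq)
    then show "x \<in> (\<Union>i\<in>I. atom_span (\<Delta> \<inter> sim_class (p i)))"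
      using atom_span_sim_class[OF f \<Delta> x] i by auto
  qed
  moreover have "atom_span (\<Delta> \<inter> sim_class (p i)) \<subseteq> atom_span \<Delta>" for i
    by (rule atom_span_mono) blast
  ultimately show ?thesis unfolding * F_closure_eq_atom_span[OF f \<Delta>] by blast
qed

theorem corollary4p11:
  "(\<forall>(\<Delta> :: 'a::two_fir set) (r :: nat).
      F_algebraic \<Delta> \<and> \<Delta> \<subseteq> atoms \<and> rk \<Delta> = enat r \<longrightarrow>
        finite (sim_classes_meeting \<Delta>) \<and>
        (\<exists>(n :: nat) (p :: nat \<Rightarrow> 'a).
           n \<le> r \<and>
           (\<forall>i\<in>{1..n}. p i \<in> atoms) \<and>
           (\<forall>i\<in>{1..n}. \<forall>j\<in>{1..n}. i \<noteq> j \<longrightarrow> \<not> similar (p i) (p j)) \<and>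
           \<Delta> = (\<Union>i\<in>{1..n}. \<Delta> \<inter> sim_class (p i)) \<and>
           (\<forall>B :: nat \<Rightarrow> 'a set.
              (\<forall>i\<in>{1..n}. F_basis (B i) (\<Delta> \<inter> sim_class (p i))) \<longrightarrow>
              F_basis (\<Union>i\<in>{1..n}. B i) \<Delta>) \<and>
           rk \<Delta> = (\<Sum>i\<in>{1..n}. rk (\<Delta> \<inter> sim_class (p i))) \<and>
           F_closure \<Delta> = (\<Union>i\<in>{1..n}. F_closure (\<Delta> \<inter> sim_class (p i))))) \<and>
   (\<forall>f\<in>(fin_length :: 'a set). ecard (sim_classes_meeting (V f)) \<le> ell f)"
proof ((rule conjI; intro allI ballI impI), goal_cases)
  case (1 \<Delta> r)
  then have alg: "F_algebraic \<Delta>" and atoms: "\<Delta> \<subseteq> atoms" and rk: "rk \<Delta> = enat r" by auto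
  obtain f where f: "f \<noteq> 0" and \<Delta>: "\<Delta> \<subseteq> V f"
    using iffD1[OF F_algebraic_atoms_iff[of \<Delta>]] alg atoms by metis
  \<comment> \<open>The very basis that \<open>rk\<close> chooses, so finite rank makes it finite
    with \<open>r\<close> elements.\<close>
  define B where "B = (SOME B. F_basis B \<Delta>)"
  have B: "F_basis B \<Delta>" unfolding B_def using F_basis_exists[OF f \<Delta>] by (rule someI_ex)
  have "ecard B = enat r" using rk by (simp add: rk_def B_def)
  then have fin: "finite B" and card: "card B = r" by (auto simp: ecard_def split: if_splits)
  have B0: "B \<subseteq> \<Delta>" "\<Delta> \<subseteq> atom_span B" using B F_basis_iff[OF f \<Delta>] by auto
  have classes: "sim_class ` \<Delta> = sim_class ` B"
  proof (intro equalityI image_subsetI)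
    fix \<delta> assume "\<delta> \<in> \<Delta>"
    then obtain b where "b \<in> B" "similar \<delta> b"
      using atom_span_similar[OF f _ subsetD[OF B0(2)]] B0(1) \<Delta> by blast
    then show "sim_class \<delta> \<in> sim_class ` B" by (simp add: similar_imp_sim_class_eq)
  qed (use B0 in blast)
  \<comment> \<open>\<open>P\<close> takes one element of \<open>B\<close> from each class. Its
    enumeration gives the \<open>p i\<close>, and \<open>P \<subseteq> B\<close> gives
    \<open>n \<le> r\<close>.\<close>
  obtain P where P: "P \<subseteq> B" "inj_on sim_class P" "sim_class ` B = sim_class ` P"
    using iffD1[OF subset_image_inj[of "sim_class ` B" sim_class B] subset_refl] by metis
  have finP: "finite P" using P fin finite_subset by blast
  define n where "n = card P"
  obtain p where p: "bij_betw p {1..n} P" using ex_bij_betw_nat_finite_1[OF finP] n_def by blast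
  have pP: "p i \<in> P" if "i \<in> {1..n}" for i using p that by (rule bij_betw_apply)
  have nr: "n \<le> r" using card_mono[OF fin P(1)] card by (simp add: n_def)
  have patoms: "p i \<in> atoms" if "i \<in> {1..n}" for i using pP[OF that] P(1) B0(1) atoms by blast
  have nsim: "\<not> similar (p i) (p j)" if "i \<in> {1..n}" "j \<in> {1..n}" "i \<noteq> j" for i j
  proof
    assume "similar (p i) (p j)"
    then have "p i = p j" using P(2) pP that similar_imp_sim_class_eq by (metis inj_onD)
    then show False using p that by (metis bij_betw_imp_inj_on inj_onD)
  qed
  have cover: "\<Delta> = (\<Union>i\<in>{1..n}. \<Delta> \<inter> sim_class (p i))"
  proof (intro equalityI subsetI)
    fix \<delta> assume \<delta>: "\<delta> \<in> \<Delta>"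
    then have "sim_class \<delta> \<in> sim_class ` P" using classes P(3) by (metis imageI)
    then obtain q where q: "q \<in> P" "sim_class \<delta> = sim_class q" by (rule imageE)
    then obtain i where i: "i \<in> {1..n}" "q = p i" using p by (auto simp: bij_betw_def)
    have "\<delta> \<in> sim_class (p i)" using atom_in_sim_class[of \<delta>] \<delta> atoms q i by auto
    then show "\<delta> \<in> (\<Union>i\<in>{1..n}. \<Delta> \<inter> sim_class (p i))" using i \<delta> by blast
  qed auto
  \<comment> \<open>The sum formula counts the single basis \<open>B\<close> class by class.\<close>
  have rk_i: "rk (\<Delta> \<inter> sim_class (p i)) = enat (card (B \<inter> sim_class (p i)))" for i
    by (rule rk_eq_card[OF f _ F_basis_Int_sim_class[OF f \<Delta> B]]) (use \<Delta> fin in auto)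
  have "B \<subseteq> (\<Union>i\<in>{1..n}. sim_class (p i))" using equalityD1[OF cover] B0(1) by blast
  then have "B = (\<Union>i\<in>{1..n}. B \<inter> sim_class (p i))" by blast
  moreover have "(B \<inter> sim_class (p i)) \<inter> (B \<inter> sim_class (p j)) = {}"
    if "i \<in> {1..n}" "j \<in> {1..n}" "i \<noteq> j" for i j
    using nsim[OF that] similar_sym similar_trans unfolding sim_class_def by blast
  then have "card (\<Union>i\<in>{1..n}. B \<inter> sim_class (p i)) = (\<Sum>i\<in>{1..n}. card (B \<inter> sim_class (p i)))"
    using fin by (intro card_UN_disjoint) auto
  ultimately have "r = (\<Sum>i\<in>{1..n}. card (B \<inter> sim_class (p i)))" using card by simp
  then have "rk \<Delta> = enat (\<Sum>i\<in>{1..n}. card (B \<inter> sim_class (p i)))" using rk by simp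
  also have "\<dots> = (\<Sum>i\<in>{1..n}. rk (\<Delta> \<inter> sim_class (p i)))"
    unfolding rk_i by (simp add: of_nat_eq_enat[symmetric])
  finally have sum: "rk \<Delta> = (\<Sum>i\<in>{1..n}. rk (\<Delta> \<inter> sim_class (p i)))" .
  have "finite (sim_classes_meeting \<Delta>)"
    using sim_classes_meeting_eq[OF atoms] classes fin by simp
  moreover have "F_basis (\<Union>i\<in>{1..n}. C i) \<Delta>"
    if "\<forall>i\<in>{1..n}. F_basis (C i) (\<Delta> \<inter> sim_class (p i))" for C
    using F_basis_UN_sim_class[OF f \<Delta> nsim cover] that by blast
  ultimately show ?case
    using nr patoms nsim cover sum F_closure_UN_sim_class[OF f \<Delta> cover]
    by (intro conjI exI[of _ n] exI[of _ p]) blast+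
next
  case (2 f)
  then show ?case by (rule ecard_sim_classes_meeting_V)
qed

end
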